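(* Let $q$ be a prime power and let $\mathcal{L}$ be a Cameron-Liebler set of generators on the Klein quadric $Q^+(5,q)$ with parameter $x$ satisfying $1\leq x<\sqrt{q}+1$. Then $\mathcal{L}$ is the union of $x$ point-pencils, defined by $x$ points which are pairwise non-collinear on the Klein quadric.
   Context: The Klein quadric $Q^+(5,q)$ is the hyperbolic quadric in $\mathrm{PG}(5,q)$ with equation $X_0X_5+X_1X_4+X_2X_3=0$. Its generators are the planes of $\mathrm{PG}(5,q)$ contained in it. Let $A$ be the $\{0,1\}$-valued point-generator incidence matrix of $Q^+(5,q)$ (rows indexed by points, columns by generators, entry $1$ iff the point lies in the generator). A set $\mathcal{L}$ of generators is a (degree one) Cameron-Liebler set if its characteristic vector (a real vector indexed by the generators) lies in $\mathrm{Im}(A^T)$ (over the reals); it has parameter $x$ if $|\mathcal{L}|=2x(q+1)$. In $Q^+(5,q)$ the notions of Cameron-Liebler set and degree one Cameron-Liebler set coincide, and the parameter $x$ of such a set is known to be a non-negative integer. The point-pencil with vertex $P$, for a point $P$ of $Q^+(5,q)$, is the set of all $2(q+1)$ generators of $Q^+(5,q)$ containing $P$ (it is a Cameron-Liebler set with parameter $1$). Two distinct points of $Q^+(5,q)$ are non-collinear on the Klein quadric if the line of $\mathrm{PG}(5,q)$ joining them is not contained in $Q^+(5,q)$. *)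

theory Defs
  imports "HOL-Analysis.Analysis"
begin

text \<open>
  PG(5,q) is the lattice of subspaces of the vector space \<open>'a ^ 6\<close> over a finite field \<open>'a\<close> with
  \<open>q = CARD('a)\<close>. A projective subspace of projective dimension \<open>d\<close> is represented by the set of
  vectors of the linear subspace of dimension \<open>d + 1\<close>. The coordinates are indexed by the
  six elements \<open>0, \<dots>, 5\<close> of the numeral type \<open>6\<close>.
\<close>

definition pg_subspaces :: "nat \<Rightarrow> ('a::{field,finite} ^ 6) set set" where
  "pg_subspaces d = {U. vec.subspace U \<and> vec.dim U = d + 1}"

definition klein_form :: "'a::{field,finite} ^ 6 \<Rightarrow> 'a" where
  "klein_form X = X $ 0 * X $ 5 + X $ 1 * X $ 4 + X $ 2 * X $ 3"

text \<open>The zero vector belongs to this set, so that a projective subspace lies on the quadric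
  iff its set of vectors is a subset of it.\<close>

definition klein_quadric :: "('a::{field,finite} ^ 6) set" where
  "klein_quadric = {X. klein_form X = 0}"

definition quadric_points :: "('a::{field,finite} ^ 6) set set" where
  "quadric_points = {P \<in> pg_subspaces 0. P \<subseteq> klein_quadric}"

definition generators :: "('a::{field,finite} ^ 6) set set" where
  "generators = {G \<in> pg_subspaces 2. G \<subseteq> klein_quadric}"

definition incidence_matrix :: "('a::{field,finite} ^ 6) set \<Rightarrow> ('a ^ 6) set \<Rightarrow> real" where
  "incidence_matrix P G = (if P \<subseteq> G then 1 else 0)"

text \<open>Real vectors indexed by the generators are represented by functions restricted to
  \<open>generators\<close>.\<close>

definition image_incidence_transpose :: "(('a::{field,finite} ^ 6) set \<Rightarrow> real) set" where
  "image_incidence_transpose =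
     range (\<lambda>c. \<lambda>G\<in>generators. \<Sum>P\<in>quadric_points. incidence_matrix P G * c P)"

definition characteristic_vector ::
    "('a::{field,finite} ^ 6) set set \<Rightarrow> ('a ^ 6) set \<Rightarrow> real" where
  "characteristic_vector L = (\<lambda>G\<in>generators. if G \<in> L then 1 else 0)"

definition cameron_liebler_set :: "('a::{field,finite} ^ 6) set set \<Rightarrow> bool" where
  "cameron_liebler_set L \<longleftrightarrow>
     L \<subseteq> generators \<and> characteristic_vector L \<in> image_incidence_transpose"

text \<open>Integrality of the parameter is a property of Cameron-Liebler sets, not part of the
  definition.\<close>

definition has_parameter :: "('a::{field,finite} ^ 6) set set \<Rightarrow> real \<Rightarrow> bool" where
  "has_parameter L x \<longleftrightarrow> real (card L) = 2 * x * (real CARD('a) + 1)"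

definition point_pencil :: "('a::{field,finite} ^ 6) set \<Rightarrow> ('a ^ 6) set set" where
  "point_pencil P = {G \<in> generators. P \<subseteq> G}"

definition non_collinear :: "('a::{field,finite} ^ 6) set \<Rightarrow> ('a ^ 6) set \<Rightarrow> bool" where
  "non_collinear P R \<longleftrightarrow> P \<noteq> R \<and> \<not> vec.span (P \<union> R) \<subseteq> klein_quadric"

end

theory Submission
  imports Defs
begin

text \<open>
  A singular vector \<open>X\<close> is read as an alternating \<open>4 \<times> 4\<close> matrix \<open>M(X)\<close> of Pfaffian \<open>0\<close>, hence as the
  line of PG(3,q) whose points are the \<open>a\<close> with \<open>M(X) a = 0\<close>; the matrix with the reversed
  coordinates gives the planes \<open>b\<close> through that line in the same way. This is the Klein
  correspondence. Every generator then is the set of all lines through a point \<open>a\<close> (\<open>latin a\<close>) or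
  the set of all lines in a plane \<open>b\<close> (\<open>greek b\<close>). To see this, a vector that is killed by
  all matrices of a totally singular set is produced by multiplying with one matrix after the other
  (\<open>totally_singular_in_latin_or_greek\<close>).

  So a set \<open>L\<close> of generators is a set \<open>F\<close> of points together with a set \<open>H\<close> of planes of PG(3,q). If the
  characteristic vector of \<open>L\<close> is a combination of the rows of the incidence matrix, its coefficients
  are weights on the lines, with sum the parameter \<open>x\<close>. A point, or a plane, has
  total weight \<open>1\<close> or \<open>0\<close> on the lines incident with it, according as it belongs to \<open>L\<close> or not. Since a plane
  meets a line in \<open>1\<close> or in \<open>q + 1\<close> points, it contains \<open>x\<close> points of \<open>F\<close> if it is not in \<open>H\<close>, and
  \<open>x + q\<close> points if it is (\<open>weighted_lines_hyperplane\<close>); dually for the planes of \<open>H\<close> on a point.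
  It follows that every line has as many points in \<open>F\<close> as it has planes in \<open>H\<close> (\<open>line_balance\<close>). Hence \<open>F\<close>
  meets every line of a plane in \<open>H\<close>, so that it cuts out a blocking set of size
  \<open>x + q < q + \<surd>q + 1\<close> in that plane. Bruen's bound on nontrivial blocking sets forces this set to contain a
  full line (\<open>contains_full_line\<close>). All points and all planes of this line belong to \<open>L\<close>, that is, \<open>L\<close>
  contains a point-pencil. Removing it lowers the weight of one line by \<open>1\<close>, which leaves a
  Cameron-Liebler set of parameter \<open>x - 1\<close>, and induction writes \<open>L\<close> as a disjoint union of
  point-pencils. Collinear points lie on a common generator, so the vertices of disjoint
  pencils are non-collinear.

  All counts are made with nonzero vectors in place of projective points, which multiplies
  them by \<open>q - 1\<close>.
\<close>

section \<open>Counting in vector spaces over a finite field\<close>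

lemma card_subspace:
  fixes U :: "('a::{field,finite} ^ 'n) set"
  assumes "vec.subspace U"
  shows "card U = CARD('a) ^ vec.dim U"
proof -
  obtain B where B: "B \<subseteq> U" "vec.independent B" "U \<subseteq> vec.span B" "card B = vec.dim U"
    using vec.basis_exists by metis
  have U: "U = vec.span B"
    using B(1,3) vec.span_minimal[OF B(1) assms] by blast
  define F where "F = (\<Pi>\<^sub>E b\<in>B. (UNIV :: 'a set))"
  define h where "h = (\<lambda>c. \<Sum>b\<in>B. c b *s b)"
  have fin: "finite B" by simp
  have inj: "inj_on h F"
  proof (rule inj_onI)
    fix c d assume cd: "c \<in> F" "d \<in> F" "h c = h d"
    have "(\<Sum>b\<in>B. (c b - d b) *s b) = 0"
      using cd(3) by (simp add: h_def vec.scale_left_diff_distrib sum_subtractf)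
    hence "c b - d b = 0" if "b \<in> B" for b
      using vec.independentD[OF B(2) fin subset_refl, of "\<lambda>b. c b - d b"] that by blast
    thus "c = d"
      using cd(1,2) by (auto simp: F_def intro: PiE_ext)
  qed
  have img: "h ` F = U"
  proof
    show "h ` F \<subseteq> U"
      unfolding U h_def
      by (rule image_subsetI, rule vec.span_sum) (auto intro: vec.span_scale vec.span_base)
    show "U \<subseteq> h ` F"
    proof
      fix u assume "u \<in> U"
      then obtain c where "u = (\<Sum>b\<in>B. c b *s b)"
        unfolding U vec.span_finite[OF fin] by auto
      hence "u = h (restrict c B)" by (simp add: h_def)
      thus "u \<in> h ` F" by (auto simp: F_def)
    qed
  qed
  have "card U = card F" using card_image[OF inj] img by simp
  thus ?thesis by (simp add: F_def card_PiE B(4))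
qed

text \<open>
  The fibres over the image of \<open>h\<close> are translates of the kernel.
\<close>

lemma card_additive_image:
  fixes h :: "('b::ab_group_add) \<Rightarrow> ('c::ab_group_add)"
  assumes "finite A" and diff: "\<And>x y. x \<in> A \<Longrightarrow> y \<in> A \<Longrightarrow> x - y \<in> A"
    and sum: "\<And>x y. x \<in> A \<Longrightarrow> y \<in> A \<Longrightarrow> x + y \<in> A"
    and add: "\<And>x y. h (x + y) = h x + h y"
  shows "card A = card (h ` A) * card {x\<in>A. h x = 0}"
proof -
  have hd: "h (x - y) = h x - h y" for x y
    using add[of "x - y" y] by (simp add: algebra_simps)
  have fib: "card {x\<in>A. h x = v} = card {x\<in>A. h x = 0}" if "v \<in> h ` A" for v
  proof -
    from that obtain z where z: "z \<in> A" "v = h z" by auto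
    have "bij_betw (\<lambda>x. x + z) {x\<in>A. h x = 0} {x\<in>A. h x = v}"
    proof (rule bij_betw_byWitness[where f' = "\<lambda>x. x - z"])
      show "(\<lambda>x. x + z) ` {x\<in>A. h x = 0} \<subseteq> {x\<in>A. h x = v}"
        using z sum by (auto simp: add)
      show "(\<lambda>x. x - z) ` {x\<in>A. h x = v} \<subseteq> {x\<in>A. h x = 0}"
        using z diff by (auto simp: hd)
    qed auto
    from bij_betw_same_card[OF this] show ?thesis by (rule sym)
  qed
  have "card A = (\<Sum>v\<in>h ` A. card {x\<in>A. h x = v})"
    unfolding card_eq_sum by (rule sum.image_gen[OF assms(1)])
  also have "\<dots> = card (h ` A) * card {x\<in>A. h x = 0}"
    using fib by simp
  finally show ?thesis .
qed

definition dotp :: "'a::field ^ 4 \<Rightarrow> 'a ^ 4 \<Rightarrow> 'a" where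
  "dotp a b = a$1 * b$1 + a$2 * b$2 + a$3 * b$3 + a$4 * b$4"

lemma dotp_simps [simp]:
  "dotp (a + a') b = dotp a b + dotp a' b" "dotp a (b + b') = dotp a b + dotp a b'"
  "dotp (a - a') b = dotp a b - dotp a' b" "dotp a (b - b') = dotp a b - dotp a b'"
  "dotp (s *s a) b = s * dotp a b" "dotp a (s *s b) = s * dotp a b"
  "dotp 0 b = 0" "dotp a 0 = 0"
  by (simp_all add: dotp_def algebra_simps)

lemma dotp_commute: "dotp a b = dotp b a"
  by (simp add: dotp_def mult.commute)

lemma dotp_axis: "dotp a (axis i 1) = a $ i"
  using exhaust_4[of i] by (auto simp: dotp_def axis_def)

lemma dotp_eq_1:
  assumes "a \<noteq> 0"
  obtains w where "dotp a w = 1"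
proof -
  from assms obtain i where "a $ i \<noteq> 0" by (auto simp: vec_eq_iff)
  hence "dotp a (inverse (a $ i) *s axis i 1) = 1" by (simp add: dotp_axis)
  thus thesis by (rule that)
qed

text \<open>
  A linear functional that does not vanish on \<open>A\<close> maps \<open>A\<close> onto the field, so that its kernel has index \<open>q\<close>.
\<close>

lemma card_orthogonal:
  fixes A :: "('a::{field,finite} ^ 4) set"
  assumes A: "vec.subspace A" and c: "c \<in> A" "dotp c b \<noteq> 0"
  shows "card A = CARD('a) * card {a\<in>A. dotp a b = 0}"
proof -
  have "UNIV = (\<lambda>a. dotp a b) ` A"
  proof (rule UNIV_eq_I)
    fix s
    have "(s / dotp c b) *s c \<in> A" using A c(1) by (rule vec.subspace_scale)
    moreover have "dotp ((s / dotp c b) *s c) b = s" using c(2) by simp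
    ultimately show "s \<in> (\<lambda>a. dotp a b) ` A" by (metis image_eqI)
  qed
  thus ?thesis
    using card_additive_image[of A "\<lambda>a. dotp a b"] A
    by (simp add: vec.subspace_add vec.subspace_diff)
qed

section \<open>Vectors of length six as alternating matrices\<close>

definition flip :: "'a::field ^ 6 \<Rightarrow> 'a ^ 6" where
  "flip X = (\<chi> i. X $ (5 - i))"

text \<open>
  The alternating matrix with the entries \<open>X\<^sub>0, X\<^sub>1, X\<^sub>2, X\<^sub>3, -X\<^sub>4, X\<^sub>5\<close> above the diagonal (read row by row), applied
  to \<open>a\<close>. Its Pfaffian is the Klein form, and \<open>flip X\<close> gives its Pfaffian adjugate up to sign.
\<close>

definition skew :: "'a::field ^ 6 \<Rightarrow> 'a ^ 4 \<Rightarrow> 'a ^ 4" where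
  "skew X a = (\<chi> i.
     if i = 1 then X$0 * a$2 + X$1 * a$3 + X$2 * a$4
     else if i = 2 then - X$0 * a$1 + X$3 * a$3 - X$4 * a$4
     else if i = 3 then - X$1 * a$1 - X$3 * a$2 + X$5 * a$4
     else - X$2 * a$1 + X$4 * a$2 - X$5 * a$3)"

text \<open>
  The Pluecker coordinates of the line in which the planes \<open>u\<close> and \<open>v\<close> meet, in the order and with the signs that make
  \<open>skew (join u v)\<close> the matrix \<open>v u\<^sup>T - u v\<^sup>T\<close>.
\<close>

definition join :: "'a::field ^ 4 \<Rightarrow> 'a ^ 4 \<Rightarrow> 'a ^ 6" where
  "join u v = (\<chi> i.
     if i = 0 then v$1 * u$2 - u$1 * v$2
     else if i = 1 then v$1 * u$3 - u$1 * v$3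
     else if i = 2 then v$1 * u$4 - u$1 * v$4
     else if i = 3 then v$2 * u$3 - u$2 * v$3
     else if i = 4 then u$2 * v$4 - v$2 * u$4
     else v$3 * u$4 - u$3 * v$4)"

lemma UNIV_6: "(UNIV :: 6 set) = {0, 1, 2, 3, 4, 5}"
  by (rule sym, rule card_subset_eq) auto

lemma vec_6_eq_iff:
  "X = Y \<longleftrightarrow> X$0 = Y$0 \<and> X$1 = Y$1 \<and> X$2 = Y$2 \<and> X$3 = Y$3 \<and> X$4 = Y$4 \<and> X$(5::6) = Y$5"
proof -
  have "X = Y \<longleftrightarrow> (\<forall>i\<in>UNIV. X $ i = Y $ i)" by (simp add: vec_eq_iff)
  thus ?thesis unfolding UNIV_6 by simp
qed

lemma vec_4_eq_iff: "a = b \<longleftrightarrow> a$1 = b$1 \<and> a$2 = b$2 \<and> a$3 = b$3 \<and> a$(4::4) = b$4"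
  by (simp add: vec_eq_iff forall_4)

lemma flip_nth [simp]:
  "flip X $ 0 = X$5" "flip X $ 1 = X$4" "flip X $ 2 = X$3"
  "flip X $ 3 = X$2" "flip X $ 4 = X$1" "flip X $ 5 = X$0"
  by (simp_all add: flip_def)

lemma skew_nth:
  "skew X a $ 1 = X$0 * a$2 + X$1 * a$3 + X$2 * a$4"
  "skew X a $ 2 = - X$0 * a$1 + X$3 * a$3 - X$4 * a$4"
  "skew X a $ 3 = - X$1 * a$1 - X$3 * a$2 + X$5 * a$4"
  "skew X a $ 4 = - X$2 * a$1 + X$4 * a$2 - X$5 * a$3"
  by (simp_all add: skew_def)

lemma join_nth:
  "join u v $ 0 = v$1 * u$2 - u$1 * v$2" "join u v $ 1 = v$1 * u$3 - u$1 * v$3"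
  "join u v $ 2 = v$1 * u$4 - u$1 * v$4" "join u v $ 3 = v$2 * u$3 - u$2 * v$3"
  "join u v $ 4 = u$2 * v$4 - v$2 * u$4" "join u v $ 5 = v$3 * u$4 - u$3 * v$4"
  by (simp_all add: join_def)

lemma flip_flip [simp]: "flip (flip X) = X"
  by (simp add: vec_6_eq_iff)

lemma flip_linear:
  "flip (X + Y) = flip X + flip Y" "flip (s *s X) = s *s flip X" "flip 0 = 0"
  by (simp_all add: vec_6_eq_iff)

lemma flip_eq_0_iff [simp]: "flip X = 0 \<longleftrightarrow> X = 0"
  by (auto simp: vec_6_eq_iff)

lemma klein_form_flip [simp]: "klein_form (flip X) = klein_form X"
  by (simp add: klein_form_def algebra_simps)

lemma skew_linear [simp]:
  "skew (X + Y) a = skew X a + skew Y a" "skew X (a + b) = skew X a + skew X b"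
  "skew (s *s X) a = s *s skew X a" "skew X (s *s a) = s *s skew X a"
  "skew 0 a = 0" "skew X 0 = 0"
  by (simp_all add: vec_4_eq_iff skew_nth algebra_simps)

lemma dotp_skew: "dotp (skew X a) b = - dotp a (skew X b)"
  by (simp add: dotp_def skew_nth algebra_simps)

lemma dotp_skew_self: "dotp a (skew X a) = 0"
  by (simp add: dotp_def skew_nth algebra_simps)

text \<open>
  A Clifford relation: the two half-spin modules of the Klein form are two copies of the space of
  vectors of length four, on which \<open>X\<close> acts by \<open>skew X\<close> and by \<open>skew (flip X)\<close>.
\<close>

lemma skew_skew_flip: "skew X (skew (flip X) a) = - klein_form X *s a"
  by (simp add: vec_4_eq_iff skew_nth klein_form_def algebra_simps)

text \<open>
  Orthogonality with respect to the polar form of the Klein form.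
\<close>

definition conjugate :: "'a::{field,finite} ^ 6 \<Rightarrow> 'a ^ 6 \<Rightarrow> bool" where
  "conjugate X Y \<longleftrightarrow> klein_form (X + Y) = klein_form X + klein_form Y"

text \<open>
  This is the polarization of \<open>skew_skew_flip\<close>.
\<close>

lemma skew_anticommute:
  assumes "conjugate X Y"
  shows "skew X (skew (flip Y) a) = - skew Y (skew (flip X) a)"
proof -
  have "skew X (skew (flip Y) a) + skew Y (skew (flip X) a)
      = - (klein_form (X + Y) - klein_form X - klein_form Y) *s a"
    by (simp add: vec_4_eq_iff skew_nth klein_form_def algebra_simps)
  thus ?thesis using assms by (simp add: conjugate_def add_eq_0_iff2)
qed

lemma skew_join: "skew (join u v) w = dotp u w *s v - dotp v w *s u"
  by (simp add: vec_4_eq_iff skew_nth join_nth dotp_def algebra_simps)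

lemma klein_form_join: "klein_form (join u v) = 0"
  by (simp add: klein_form_def join_nth algebra_simps)

section \<open>The line of PG(3,q) given by a singular vector\<close>

lemma CARD_field_ge_2: "CARD('a::{field,finite}) \<ge> 2"
proof -
  have "card {0, 1 :: 'a} \<le> CARD('a)" by (rule card_mono) auto
  thus ?thesis by simp
qed

lemma subspace_ker_skew: "vec.subspace {a. skew X a = 0}"
  by (auto simp: vec.subspace_def)

lemma card_hyperplane:
  fixes b :: "'a::{field,finite} ^ 4"
  assumes "b \<noteq> 0"
  shows "card {a. dotp a b = 0} = CARD('a) ^ 3"
proof -
  obtain c where "dotp b c = 1" using dotp_eq_1[OF assms] .
  hence "CARD('a) ^ 4 = CARD('a) * card {a. dotp a b = 0}"
    using card_orthogonal[OF vec.subspace_UNIV, of c b] by (simp add: dotp_commute)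
  thus ?thesis by (simp add: power_numeral_reduce)
qed

text \<open>
  If the entry of the matrix in row \<open>i\<close> and column \<open>j\<close> is nonzero, then rows \<open>i\<close> and \<open>j\<close> express the
  coordinates \<open>i\<close> and \<open>j\<close> of a vector in the kernel through the other two.
\<close>

lemma card_ker_skew_le:
  fixes X :: "'a::{field,finite} ^ 6"
  assumes "X \<noteq> 0"
  shows "card {a. skew X a = 0} \<le> CARD('a) ^ 2"
proof -
  have "\<exists>j k. \<forall>a. skew X a = 0 \<longrightarrow> a $ j = 0 \<longrightarrow> a $ k = 0 \<longrightarrow> a = 0"
  proof -
    from assms consider "X$0 \<noteq> 0" | "X$1 \<noteq> 0" | "X$2 \<noteq> 0" | "X$3 \<noteq> 0" | "X$4 \<noteq> 0" | "X$5 \<noteq> 0"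
      by (auto simp: vec_6_eq_iff)
    thus ?thesis
    proof cases
      case 1 thus ?thesis by (intro exI[of _ 3] exI[of _ 4]) (auto simp: vec_4_eq_iff skew_nth)
    next
      case 2 thus ?thesis by (intro exI[of _ 2] exI[of _ 4]) (auto simp: vec_4_eq_iff skew_nth)
    next
      case 3 thus ?thesis by (intro exI[of _ 2] exI[of _ 3]) (auto simp: vec_4_eq_iff skew_nth)
    next
      case 4 thus ?thesis by (intro exI[of _ 1] exI[of _ 4]) (auto simp: vec_4_eq_iff skew_nth)
    next
      case 5 thus ?thesis by (intro exI[of _ 1] exI[of _ 3]) (auto simp: vec_4_eq_iff skew_nth)
    next
      case 6 thus ?thesis by (intro exI[of _ 1] exI[of _ 2]) (auto simp: vec_4_eq_iff skew_nth)
    qed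
  qed
  then obtain j k where jk: "\<And>a. skew X a = 0 \<Longrightarrow> a $ j = 0 \<Longrightarrow> a $ k = 0 \<Longrightarrow> a = 0"
    by blast
  have "inj_on (\<lambda>a. (a $ j, a $ k)) {a. skew X a = 0}"
  proof (rule inj_onI)
    fix a b assume ab: "a \<in> {a. skew X a = 0}" "b \<in> {a. skew X a = 0}"
      "(a $ j, a $ k) = (b $ j, b $ k)"
    have "a - b \<in> {a. skew X a = 0}"
      using ab(1,2) by (rule vec.subspace_diff[OF subspace_ker_skew])
    hence "a - b = 0" using ab(3) jk[of "a - b"] by simp
    thus "a = b" by simp
  qed
  hence "card {a. skew X a = 0} \<le> card (UNIV :: ('a \<times> 'a) set)"
    by (rule card_inj_on_le) auto
  thus ?thesis by (simp add: power2_eq_square)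
qed

text \<open>
  The product of the two matrices is \<open>0\<close>, so the range of each one lies in the kernel of the other.
  As both kernels have at most \<open>q\<^sup>2\<close> elements, rank and nullity leave only equality.
\<close>

lemma
  fixes X :: "'a::{field,finite} ^ 6"
  assumes X: "X \<noteq> 0" "klein_form X = 0"
  shows card_ker_skew: "card {a. skew X a = 0} = CARD('a) ^ 2"
    and range_skew: "range (skew X) = {b. skew (flip X) b = 0}"
proof -
  let ?q = "CARD('a)"
  have q: "?q > 0" by simp
  have sub: "range (skew X) \<subseteq> {b. skew (flip X) b = 0}"
    using skew_skew_flip[of "flip X"] X by auto
  have rn: "?q ^ 4 = card (range (skew X)) * card {a. skew X a = 0}"
    using card_additive_image[of UNIV "skew X"] by simp
  have le: "card {a. skew X a = 0} \<le> ?q ^ 2" "card {b. skew (flip X) b = 0} \<le> ?q ^ 2"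
    using card_ker_skew_le[of X] card_ker_skew_le[of "flip X"] X by simp_all
  have le': "card (range (skew X)) \<le> card {b. skew (flip X) b = 0}"
    using sub by (intro card_mono) auto
  have q4: "?q ^ 4 = ?q ^ 2 * ?q ^ 2" by (simp flip: power_add)
  have "?q ^ 2 * ?q ^ 2 = card (range (skew X)) * card {a. skew X a = 0}"
    using rn unfolding q4 .
  also have "\<dots> \<le> ?q ^ 2 * card {a. skew X a = 0}"
    by (rule mult_le_mono1[OF order_trans[OF le' le(2)]])
  finally have "?q ^ 2 \<le> card {a. skew X a = 0}" unfolding mult_le_cancel1 using q by simp
  thus k: "card {a. skew X a = 0} = ?q ^ 2" using le(1) by simp
  have "card (range (skew X)) * ?q ^ 2 = ?q ^ 2 * ?q ^ 2"
    using rn unfolding k q4 by (rule sym)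
  hence "card (range (skew X)) = ?q ^ 2" unfolding mult_cancel2 using q by simp
  thus "range (skew X) = {b. skew (flip X) b = 0}"
    using sub le le' by (intro card_subset_eq) auto
qed

text \<open>
  The points of the line of \<open>X\<close> are incident with the planes of the line, because the latter are the
  range of an antisymmetric matrix that kills the former.
\<close>

lemma ker_skew_orthogonal:
  fixes X :: "'a::{field,finite} ^ 6"
  assumes "X \<noteq> 0" "klein_form X = 0" "skew X a = 0" "skew (flip X) b = 0"
  shows "dotp a b = 0"
proof -
  from range_skew[OF assms(1,2)] assms(4) obtain w where "b = skew X w" by blast
  thus ?thesis using dotp_skew[of X a w] assms(3) by simp
qed

lemma ker_skew_flip_if_orthogonal:
  fixes X :: "'a::{field,finite} ^ 6"
  assumes "klein_form X = 0" "\<And>a. skew X a = 0 \<Longrightarrow> dotp a b = 0"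
  shows "skew (flip X) b = 0"
proof (rule ccontr)
  assume "skew (flip X) b \<noteq> 0"
  then obtain w where "dotp (skew (flip X) b) w = 1" by (rule dotp_eq_1)
  moreover have "skew X (skew (flip X) w) = 0"
    using assms(1) by (simp add: skew_skew_flip)
  hence "dotp (skew (flip X) w) b = 0" by (rule assms(2))
  ultimately show False
    using dotp_skew[of "flip X" w b] by (simp add: dotp_commute)
qed

text \<open>
  In PG(3,q), a plane meets a line not contained in it in a single point.
\<close>

lemma card_ker_skew_hyperplane:
  fixes X :: "'a::{field,finite} ^ 6"
  assumes X: "X \<noteq> 0" "klein_form X = 0"
  shows "card {a. skew X a = 0 \<and> dotp a b = 0} =
    (if skew (flip X) b = 0 then CARD('a) ^ 2 else CARD('a))"
proof (cases "skew (flip X) b = 0")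
  case True
  hence "{a. skew X a = 0 \<and> dotp a b = 0} = {a. skew X a = 0}"
    using ker_skew_orthogonal[OF X] by blast
  thus ?thesis using True card_ker_skew[OF X] by simp
next
  case False
  then obtain c where "skew X c = 0" "dotp c b \<noteq> 0"
    using ker_skew_flip_if_orthogonal[OF X(2), of b] by blast
  hence "CARD('a) * CARD('a) = CARD('a) * card {a. skew X a = 0 \<and> dotp a b = 0}"
    using card_orthogonal[OF subspace_ker_skew, of c X b] card_ker_skew[OF X]
    by (simp add: power2_eq_square)
  thus ?thesis using False by simp
qed

lemma join_eq_0_imp_parallel:
  fixes u v :: "'a::{field,finite} ^ 4"
  assumes "join u v = 0" "u \<noteq> 0"
  obtains s where "v = s *s u"
proof -
  obtain w where w: "dotp u w = 1" using dotp_eq_1[OF assms(2)] .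
  have "v = dotp v w *s u" using skew_join[of u v w] w assms(1) by simp
  thus thesis by (rule that)
qed

lemma join_parallel [simp]: "join u (s *s u) = 0" "join (s *s u) u = 0"
  by (simp_all add: vec_6_eq_iff join_nth)

lemma skew_join_eq_0_iff:
  assumes "join u v \<noteq> 0"
  shows "skew (join u v) w = 0 \<longleftrightarrow> dotp u w = 0 \<and> dotp v w = 0"
proof
  assume "skew (join u v) w = 0"
  hence eq: "dotp u w *s v = dotp v w *s u" by (simp add: skew_join)
  have div: "b = (t / s) *s a" if "s *s b = t *s a" "s \<noteq> 0" for s t and a b :: "'a ^ 4"
  proof -
    have "b = inverse s *s (s *s b)" using that(2) by simp
    thus ?thesis using that(1) by (simp add: field_simps)
  qed
  show "dotp u w = 0 \<and> dotp v w = 0"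
    using div[OF eq] div[OF eq[symmetric]] assms by (metis join_parallel)
qed (simp add: skew_join)

section \<open>The generators of the Klein quadric\<close>

definition latin :: "'a::{field,finite} ^ 4 \<Rightarrow> ('a ^ 6) set" where
  "latin a = {X. skew X a = 0}"

definition greek :: "'a::{field,finite} ^ 4 \<Rightarrow> ('a ^ 6) set" where
  "greek b = {X. skew (flip X) b = 0}"

lemma greek_eq_flip_latin: "greek b = flip ` latin b"
  by (auto simp: greek_def latin_def image_iff) (metis flip_flip)

lemma subspace_latin: "vec.subspace (latin a)"
  by (auto simp: latin_def vec.subspace_def)

lemma subspace_greek: "vec.subspace (greek a)"
  by (auto simp: greek_def vec.subspace_def flip_linear)

text \<open>
  The map \<open>X \<mapsto> skew X a\<close> has the hyperplane orthogonal to \<open>a\<close> as its range: a preimage of \<open>v\<close> is \<open>join u v\<close>,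
  where \<open>u\<close> is any vector with product \<open>1\<close> with \<open>a\<close>.
\<close>

lemma card_latin:
  fixes a :: "'a::{field,finite} ^ 4"
  assumes "a \<noteq> 0"
  shows "card (latin a) = CARD('a) ^ 3"
proof -
  obtain u where u: "dotp a u = 1" using dotp_eq_1[OF assms] .
  have "range (\<lambda>X. skew X a) = {v. dotp v a = 0}"
  proof
    show "range (\<lambda>X. skew X a) \<subseteq> {v. dotp v a = 0}"
      using dotp_skew_self[of a] by (auto simp: dotp_commute)
    show "{v. dotp v a = 0} \<subseteq> range (\<lambda>X. skew X a)"
    proof
      fix v assume "v \<in> {v. dotp v a = 0}"
      hence "v = skew (join u v) a" using u by (simp add: skew_join dotp_commute)
      thus "v \<in> range (\<lambda>X. skew X a)" by blast
    qed
  qed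
  hence rn: "CARD('a) ^ 6 = CARD('a) ^ 3 * card (latin a)"
    using card_additive_image[of UNIV "\<lambda>X. skew X a"] card_hyperplane[OF assms]
    by (simp add: latin_def)
  have "CARD('a) ^ 6 = CARD('a) ^ 3 * CARD('a) ^ 3" by (simp flip: power_add)
  hence "CARD('a) ^ 3 * card (latin a) = CARD('a) ^ 3 * CARD('a) ^ 3" unfolding rn .
  thus ?thesis unfolding mult_cancel1 by simp
qed

lemma card_greek:
  fixes a :: "'a::{field,finite} ^ 4"
  assumes "a \<noteq> 0"
  shows "card (greek a) = CARD('a) ^ 3"
proof -
  have "inj_on flip (latin a)" by (metis flip_flip inj_onI)
  thus ?thesis using card_latin[OF assms] by (simp add: greek_eq_flip_latin card_image)
qed

text \<open>
  Over a finite field the dimension of a generator can be read off from its cardinality.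
\<close>

lemma generators_card:
  "G \<in> generators \<longleftrightarrow> vec.subspace G \<and> card G = CARD('a) ^ 3 \<and> G \<subseteq> klein_quadric"
  for G :: "('a::{field,finite} ^ 6) set"
proof -
  have "vec.dim G = 2 + 1 \<longleftrightarrow> card G = CARD('a) ^ 3" if "vec.subspace G"
    using card_subspace[OF that] CARD_field_ge_2[where 'a='a]
    by (simp add: power_inject_exp)
  thus ?thesis by (auto simp: generators_def pg_subspaces_def)
qed

lemma latin_generator: "a \<noteq> 0 \<Longrightarrow> latin a \<in> generators"
proof -
  assume a: "a \<noteq> 0"
  have "klein_form X = 0" if "skew X a = 0" for X
    using skew_skew_flip[of "flip X" a] that a by simp
  hence "latin a \<subseteq> klein_quadric" by (auto simp: latin_def klein_quadric_def)
  thus ?thesis using a by (simp add: generators_card card_latin subspace_latin)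
qed

lemma greek_generator: "a \<noteq> 0 \<Longrightarrow> greek a \<in> generators"
proof -
  assume a: "a \<noteq> 0"
  have "greek a \<subseteq> klein_quadric"
    using latin_generator[OF a] by (auto simp: generators_card greek_eq_flip_latin klein_quadric_def)
  thus ?thesis using a by (simp add: generators_card card_greek subspace_greek)
qed

lemma conjugate_flip [simp]: "conjugate (flip X) (flip Y) \<longleftrightarrow> conjugate X Y"
  by (simp add: conjugate_def flip: flip_linear)

text \<open>
  The elements of \<open>A\<close> are adjoined one by one. If \<open>a\<close> is killed by the previous ones but not by \<open>X\<close>, it is
  replaced by its image under the matrix of \<open>X\<close>. This image is killed by \<open>X\<close> as \<open>X\<close> is singular,
  and by the previous vectors as they anticommute with \<open>X\<close>. Each replacement exchanges the two families.
\<close>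

lemma totally_singular_in_latin_or_greek:
  fixes A :: "('a::{field,finite} ^ 6) set"
  assumes "\<And>X. X \<in> A \<Longrightarrow> klein_form X = 0"
    and "\<And>X Y. X \<in> A \<Longrightarrow> Y \<in> A \<Longrightarrow> conjugate X Y"
  shows "\<exists>a. a \<noteq> 0 \<and> (A \<subseteq> latin a \<or> A \<subseteq> greek a)"
proof -
  have "finite A" by simp
  thus ?thesis using assms
  proof (induction A rule: finite_induct)
    case empty
    show ?case by (intro exI[of _ "axis 1 1"]) (simp add: axis_eq_0_iff)
  next
    case (insert X A)
    have step: "skew X a = 0 \<or> (skew X a \<noteq> 0 \<and> insert X A \<subseteq> greek (skew X a))"
      if "A \<subseteq> latin a" for a
    proof -
      have "skew (flip X) (skew X a) = 0"
        using skew_skew_flip[of "flip X" a] insert.prems(1)[of X] by simp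
      moreover have "skew (flip Y) (skew X a) = 0" if "Y \<in> A" for Y
        using skew_anticommute[of "flip Y" "flip X" a] insert.prems(2)[of Y X] that \<open>A \<subseteq> latin a\<close>
        by (auto simp: latin_def)
      ultimately show ?thesis by (auto simp: greek_def)
    qed
    have step': "skew (flip X) a = 0 \<or>
        (skew (flip X) a \<noteq> 0 \<and> insert X A \<subseteq> latin (skew (flip X) a))"
      if "A \<subseteq> greek a" for a
    proof -
      have "skew X (skew (flip X) a) = 0"
        using skew_skew_flip[of X a] insert.prems(1)[of X] by simp
      moreover have "skew Y (skew (flip X) a) = 0" if "Y \<in> A" for Y
        using skew_anticommute[of Y X a] insert.prems(2)[of Y X] that \<open>A \<subseteq> greek a\<close>
        by (auto simp: greek_def)
      ultimately show ?thesis by (auto simp: latin_def)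
    qed
    have "\<exists>a. a \<noteq> 0 \<and> (A \<subseteq> latin a \<or> A \<subseteq> greek a)"
      using insert.prems by (intro insert.IH) simp_all
    then obtain a where a: "a \<noteq> 0" "A \<subseteq> latin a \<or> A \<subseteq> greek a" by blast
    show ?case
    proof (cases "A \<subseteq> latin a")
      case True
      thus ?thesis using step[OF True] a(1) by (auto simp: latin_def)
    next
      case False
      thus ?thesis using step'[of a] a by (auto simp: greek_def)
    qed
  qed
qed

lemma subspace_in_latin_or_greek:
  fixes U :: "('a::{field,finite} ^ 6) set"
  assumes "vec.subspace U" "U \<subseteq> klein_quadric"
  obtains a where "a \<noteq> 0" "U \<subseteq> latin a \<or> U \<subseteq> greek a"
proof -
  have s: "klein_form X = 0" if "X \<in> U" for X
    using that assms(2) by (auto simp: klein_quadric_def)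
  have "conjugate X Y" if "X \<in> U" "Y \<in> U" for X Y
    using s[OF vec.subspace_add[OF assms(1) that]] s that by (simp add: conjugate_def)
  thus thesis using totally_singular_in_latin_or_greek[of U] s that by blast
qed

lemma generator_cases:
  assumes "G \<in> generators"
  obtains a where "a \<noteq> 0" "G = latin a" | b where "b \<noteq> 0" "G = greek b"
proof -
  obtain a where a: "a \<noteq> 0" "G \<subseteq> latin a \<or> G \<subseteq> greek a"
    using subspace_in_latin_or_greek assms unfolding generators_card by metis
  have "G = latin a" if "G \<subseteq> latin a"
    using that assms a(1) by (intro card_subset_eq) (auto simp: generators_card card_latin)
  moreover have "G = greek a" if "G \<subseteq> greek a"
    using that assms a(1) by (intro card_subset_eq) (auto simp: generators_card card_greek)
  ultimately show thesis using a that by blast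
qed

text \<open>
  All vectors \<open>join b v\<close> lie in \<open>greek b\<close>. If they lie in \<open>latin a\<close> as well, then every \<open>v\<close> whose product with \<open>a\<close>
  is \<open>1\<close> is the same multiple of \<open>b\<close>, but there are several such \<open>v\<close>.
\<close>

lemma latin_neq_greek:
  fixes a b :: "'a::{field,finite} ^ 4"
  assumes "a \<noteq> 0" "b \<noteq> 0"
  shows "latin a \<noteq> greek b"
proof
  assume eq: "latin a = greek b"
  have "join b v \<in> greek b" for v
    by (simp add: greek_def vec_4_eq_iff skew_nth join_nth algebra_simps)
  hence ker: "skew (join b v) a = 0" for v using eq by (auto simp: latin_def)
  obtain v where v: "dotp v a = 1" using dotp_eq_1[OF assms(1)] by (metis dotp_commute)
  have "\<not> {w. dotp w a = 0} \<subseteq> {0}"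
  proof
    assume "{w. dotp w a = 0} \<subseteq> {0}"
    hence "card {w. dotp w a = 0} \<le> card {0 :: 'a ^ 4}" by (rule card_mono[rotated]) simp
    moreover have "card {w. dotp w a = 0} > 1"
      unfolding card_hyperplane[OF assms(1)]
      using CARD_field_ge_2[where 'a='a] by (intro one_less_power) auto
    ultimately show False by simp
  qed
  then obtain w where w: "dotp w a = 0" "w \<noteq> 0" by auto
  have "dotp b a *s v = b" "dotp b a *s (v + w) = b"
    using ker[of v] ker[of "v + w"] v w(1) by (simp_all add: skew_join)
  hence "dotp b a *s w = 0" by (metis add_diff_cancel_left' diff_self vector_add_ldistrib)
  hence "dotp b a = 0" using w(2) by simp
  thus False using \<open>dotp b a *s v = b\<close> assms(2) by simp
qed

lemma skew_flip_join: "skew (flip (join u v)) u = 0" "skew (flip (join u v)) v = 0"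
  by (simp_all add: vec_4_eq_iff skew_nth join_nth algebra_simps)

lemma card_line:
  fixes a :: "'a::{field,finite} ^ 4"
  assumes "a \<noteq> 0"
  shows "card (range (\<lambda>s. s *s a)) = CARD('a)"
    and "card ((\<lambda>s. s *s a) ` (- {0})) = CARD('a) - 1"
proof -
  have "inj (\<lambda>s. s *s a)" using assms by (auto intro: injI)
  thus "card (range (\<lambda>s. s *s a)) = CARD('a)"
    and "card ((\<lambda>s. s *s a) ` (- {0})) = CARD('a) - 1"
    by (simp_all add: card_image inj_on_subset Compl_eq_Diff_UNIV card_Diff_subset)
qed

text \<open>
  If two different points were on the same lines, choose a plane \<open>b\<close> through the point \<open>a\<close> but not through \<open>a'\<close>.
  It meets any other plane \<open>v\<close> through \<open>a\<close> in a line on \<open>a\<close>, which then passes through \<open>a'\<close> too, which is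
  impossible since \<open>a'\<close> is not in \<open>b\<close>. So \<open>b\<close> would be the only plane through \<open>a\<close>.
\<close>

lemma latin_eq_imp_parallel:
  fixes a a' :: "'a::{field,finite} ^ 4"
  assumes "a \<noteq> 0" "a' \<noteq> 0" "latin a = latin a'"
  obtains s where "s \<noteq> 0" "a' = s *s a"
proof -
  let ?q = "CARD('a)"
  have q: "?q \<ge> 2" by (rule CARD_field_ge_2)
  have "join a a' = 0"
  proof (rule ccontr)
    assume J: "join a a' \<noteq> 0"
    have "card {w. dotp a w = 0 \<and> dotp a' w = 0} = ?q ^ 2"
      using card_ker_skew[OF J klein_form_join] by (simp add: skew_join_eq_0_iff[OF J])
    moreover have "card {w. dotp a w = 0} = ?q ^ 3"
      using card_hyperplane[OF assms(1)] by (simp add: dotp_commute)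
    moreover have "?q ^ 2 \<noteq> ?q ^ 3" using q by (simp add: power_inject_exp)
    ultimately have "{w. dotp a w = 0 \<and> dotp a' w = 0} \<noteq> {w. dotp a w = 0}" by metis
    then obtain b where b: "dotp b a = 0" "dotp b a' \<noteq> 0" by (auto simp: dotp_commute)
    have "{v. dotp v a = 0} \<subseteq> range (\<lambda>s. s *s b)"
    proof
      fix v assume "v \<in> {v. dotp v a = 0}"
      hence "join b v \<in> latin a" using b(1) by (simp add: latin_def skew_join)
      hence "join b v \<in> latin a'" unfolding assms(3) .
      hence "dotp b a' *s v = dotp v a' *s b" by (simp add: latin_def skew_join)
      hence "inverse (dotp b a') *s (dotp b a' *s v) = inverse (dotp b a') *s (dotp v a' *s b)"
        by simp
      hence "v = (inverse (dotp b a') * dotp v a') *s b" using b(2) by simp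
      thus "v \<in> range (\<lambda>s. s *s b)" by blast
    qed
    hence "card {v. dotp v a = 0} \<le> card (range (\<lambda>s. s *s b))" by (intro card_mono) auto
    also have "\<dots> \<le> ?q" by (rule card_image_le) simp
    finally have "?q ^ 3 \<le> ?q ^ 1" using card_hyperplane[OF assms(1)] by simp
    thus False using power_le_imp_le_exp[of ?q 3 1] q by simp
  qed
  then obtain s where "a' = s *s a" using join_eq_0_imp_parallel assms(1) by blast
  thus thesis using that[of s] assms(2) by auto
qed

lemma latin_scale: "s \<noteq> 0 \<Longrightarrow> latin (s *s a) = latin a"
  by (auto simp: latin_def)

lemma greek_scale: "s \<noteq> 0 \<Longrightarrow> greek (s *s a) = greek a"
  by (auto simp: greek_def)

lemma greek_eq_imp_parallel:
  fixes a a' :: "'a::{field,finite} ^ 4"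
  assumes "a \<noteq> 0" "a' \<noteq> 0" "greek a = greek a'"
  obtains s where "s \<noteq> 0" "a' = s *s a"
proof -
  have "latin a = latin a'"
    using assms(3) unfolding greek_eq_flip_latin
    by (rule inj_image_eq_iff[THEN iffD1, rotated]) (metis flip_flip injI)
  thus thesis using latin_eq_imp_parallel assms(1,2) that by blast
qed

text \<open>
  If \<open>h\<close> identifies exactly the proportional vectors, its image is a set of projective points, each with \<open>q - 1\<close> representatives.
\<close>

lemma card_projective_image:
  fixes A :: "('a::{field,finite} ^ 4) set"
  assumes "0 \<notin> A" "\<And>s a. a \<in> A \<Longrightarrow> s \<noteq> 0 \<Longrightarrow> s *s a \<in> A"
    and "\<And>s a. s \<noteq> 0 \<Longrightarrow> h (s *s a) = h a"
    and "\<And>a b. a \<in> A \<Longrightarrow> b \<in> A \<Longrightarrow> h a = h b \<Longrightarrow> \<exists>s. s \<noteq> 0 \<and> b = s *s a"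
  shows "card A = card (h ` A) * (CARD('a) - 1)"
proof -
  have "card {x\<in>A. h x = y} = CARD('a) - 1" if "y \<in> h ` A" for y
  proof -
    obtain a where a: "a \<in> A" "y = h a" using \<open>y \<in> h ` A\<close> by auto
    have "{x\<in>A. h x = y} = (\<lambda>s. s *s a) ` (- {0})"
    proof
      show "{x\<in>A. h x = y} \<subseteq> (\<lambda>s. s *s a) ` (- {0})"
        using assms(4)[OF a(1)] a(2) by fastforce
      show "(\<lambda>s. s *s a) ` (- {0}) \<subseteq> {x\<in>A. h x = y}"
        using assms(2,3) a by auto
    qed
    thus ?thesis using card_line(2)[of a] a(1) assms(1) by metis
  qed
  hence "(\<Sum>y\<in>h ` A. card {x\<in>A. h x = y}) = card (h ` A) * (CARD('a) - 1)" by simp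
  moreover have "card A = (\<Sum>y\<in>h ` A. card {x\<in>A. h x = y})"
    unfolding card_eq_sum by (rule sum.image_gen) simp
  ultimately show ?thesis by simp
qed

section \<open>Points of the quadric and their pencils\<close>

lemma quadric_points_cases:
  fixes P :: "('a::{field,finite} ^ 6) set"
  assumes "P \<in> quadric_points"
  obtains X where "X \<noteq> 0" "klein_form X = 0" "P = vec.span {X}"
proof -
  have P: "vec.subspace P" "vec.dim P = 1" "P \<subseteq> klein_quadric"
    using assms by (auto simp: quadric_points_def pg_subspaces_def)
  obtain B where B: "B \<subseteq> P" "vec.independent B" "P \<subseteq> vec.span B" "card B = vec.dim P"
    using vec.basis_exists by metis
  obtain X where X: "B = {X}" using B(4) P(2) by (metis card_1_singletonE)
  have "X \<noteq> 0" using B(2) X by (auto simp: vec.dependent_zero)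
  moreover have "klein_form X = 0" using B(1) X P(3) by (auto simp: klein_quadric_def)
  moreover have "P = vec.span {X}"
    using B(1,3) X vec.span_minimal[of "{X}" P] P(1) by blast
  ultimately show thesis by (rule that)
qed

lemma span_quadric_point:
  fixes X :: "'a::{field,finite} ^ 6"
  assumes "X \<noteq> 0" "klein_form X = 0"
  shows "vec.span {X} \<in> quadric_points"
proof -
  have "klein_form (s *s X) = s * s * klein_form X" for s
    by (simp add: klein_form_def algebra_simps)
  hence "vec.span {X} \<subseteq> klein_quadric"
    using assms(2) by (auto simp: vec.span_singleton klein_quadric_def)
  thus ?thesis
    using assms(1) by (simp add: quadric_points_def pg_subspaces_def)
qed

lemma span_subset_iff: "vec.subspace G \<Longrightarrow> vec.span {X} \<subseteq> G \<longleftrightarrow> X \<in> G"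
  by (metis empty_subsetI insert_subset vec.span_minimal vec.span_base subset_iff singletonI)

lemma point_pencil_span:
  "point_pencil (vec.span {X}) =
     latin ` {a. a \<noteq> 0 \<and> skew X a = 0} \<union> greek ` {b. b \<noteq> 0 \<and> skew (flip X) b = 0}"
proof (intro equalityI subsetI)
  fix G assume "G \<in> point_pencil (vec.span {X})"
  hence G: "G \<in> generators" "X \<in> G"
    using vec.span_base[of X "{X}"] by (auto simp: point_pencil_def)
  from G(1) show "G \<in> latin ` {a. a \<noteq> 0 \<and> skew X a = 0} \<union> greek ` {b. b \<noteq> 0 \<and> skew (flip X) b = 0}"
  proof (cases rule: generator_cases)
    case (1 a) thus ?thesis using G(2) by (auto simp: latin_def)
  next
    case (2 a) thus ?thesis using G(2) by (auto simp: greek_def)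
  qed
next
  fix G assume "G \<in> latin ` {a. a \<noteq> 0 \<and> skew X a = 0} \<union> greek ` {b. b \<noteq> 0 \<and> skew (flip X) b = 0}"
  thus "G \<in> point_pencil (vec.span {X})"
  proof
    assume "G \<in> latin ` {a. a \<noteq> 0 \<and> skew X a = 0}"
    then obtain a where "a \<noteq> 0" "G = latin a" "X \<in> latin a" by (auto simp: latin_def)
    thus ?thesis by (simp add: point_pencil_def span_subset_iff latin_generator subspace_latin)
  next
    assume "G \<in> greek ` {b. b \<noteq> 0 \<and> skew (flip X) b = 0}"
    then obtain a where "a \<noteq> 0" "G = greek a" "X \<in> greek a" by (auto simp: greek_def)
    thus ?thesis by (simp add: point_pencil_def span_subset_iff greek_generator subspace_greek)
  qed
qed

lemma card_ker_skew_nonzero: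
  fixes X :: "'a::{field,finite} ^ 6"
  assumes "X \<noteq> 0" "klein_form X = 0"
  shows "real (card {a. a \<noteq> 0 \<and> skew X a = 0}) = real CARD('a) ^ 2 - 1"
    and "real (card {a. a \<noteq> 0 \<and> skew X a = 0 \<and> dotp a b = 0}) =
      (real CARD('a) - 1) * (1 + real CARD('a) * of_bool (skew (flip X) b = 0))"
proof -
  have *: "real (card {a. a \<noteq> 0 \<and> P a}) = real (card {a. P a}) - 1" if "P 0" for P :: "'a ^ 4 \<Rightarrow> bool"
  proof -
    have "{a. P a} = insert 0 {a. a \<noteq> 0 \<and> P a}" using that by auto
    thus ?thesis by simp
  qed
  show "real (card {a. a \<noteq> 0 \<and> skew X a = 0}) = real CARD('a) ^ 2 - 1"
    using *[of "\<lambda>a. skew X a = 0"] card_ker_skew[OF assms] by simp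
  show "real (card {a. a \<noteq> 0 \<and> skew X a = 0 \<and> dotp a b = 0}) =
      (real CARD('a) - 1) * (1 + real CARD('a) * of_bool (skew (flip X) b = 0))"
    using *[of "\<lambda>a. skew X a = 0 \<and> dotp a b = 0"] card_ker_skew_hyperplane[OF assms, of b]
    by (simp add: algebra_simps power2_eq_square)
qed

lemma card_point_pencil:
  fixes P :: "('a::{field,finite} ^ 6) set"
  assumes "P \<in> quadric_points"
  shows "card (point_pencil P) = 2 * (CARD('a) + 1)"
proof -
  obtain X where X: "X \<noteq> 0" "klein_form X = 0" "P = vec.span {X}"
    using quadric_points_cases[OF assms] .
  let ?A = "{a. a \<noteq> 0 \<and> skew X a = 0}" and ?B = "{b. b \<noteq> 0 \<and> skew (flip X) b = 0}"
  have q: "real CARD('a) - 1 > 0" using CARD_field_ge_2[where 'a='a] by simp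
  have q2: "real CARD('a) ^ 2 - 1 = (real CARD('a) + 1) * (real CARD('a) - 1)"
    by (simp add: power2_eq_square algebra_simps)
  have "card ?A = card (latin ` ?A) * (CARD('a) - 1)"
    by (rule card_projective_image) (auto simp: latin_scale elim: latin_eq_imp_parallel)
  hence "real (card ?A) = real (card (latin ` ?A)) * (real CARD('a) - 1)"
    using q by (simp add: of_nat_diff)
  hence A: "real (card (latin ` ?A)) = real CARD('a) + 1"
    using q unfolding card_ker_skew_nonzero(1)[OF X(1,2)] q2 by simp
  have "card ?B = card (greek ` ?B) * (CARD('a) - 1)"
    by (rule card_projective_image) (auto simp: greek_scale elim: greek_eq_imp_parallel)
  hence "real (card ?B) = real (card (greek ` ?B)) * (real CARD('a) - 1)"
    using q by (simp add: of_nat_diff)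
  hence B: "real (card (greek ` ?B)) = real CARD('a) + 1"
    using q card_ker_skew_nonzero(1)[of "flip X"] X(1,2) unfolding q2 by simp
  have "card (latin ` ?A \<union> greek ` ?B) = card (latin ` ?A) + card (greek ` ?B)"
    using latin_neq_greek by (intro card_Un_disjoint) fastforce+
  hence "real (card (point_pencil P)) = real (2 * (CARD('a) + 1))"
    using A B by (simp add: X(3) point_pencil_span)
  thus ?thesis by (simp only: of_nat_eq_iff)
qed

lemma sum_card_swap:
  assumes "finite A" "finite B"
  shows "(\<Sum>a\<in>A. real (card {b\<in>B. R a b})) = (\<Sum>b\<in>B. real (card {a\<in>A. R a b}))"
proof -
  have "real (card {b\<in>B. R a b}) = (\<Sum>b\<in>B. of_bool (R a b))" for a
    using assms by (simp add: Int_def)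
  moreover have "real (card {a\<in>A. R a b}) = (\<Sum>a\<in>A. of_bool (R a b))" for b
    using assms by (simp add: Int_def)
  ultimately show ?thesis using sum.swap[of "\<lambda>a b. of_bool (R a b)" B A] by simp
qed

section \<open>Weighted sets of lines\<close>

text \<open>
  The indicator function of \<open>F\<close> is a weighted sum of indicator functions of lines. A plane \<open>b\<close> meets
  each line in one point and, if it contains the line, in \<open>q\<close> further ones; so counting line by line gives the
  total weight plus \<open>q\<close> times the weight of the lines in \<open>b\<close>.
\<close>

lemma weighted_lines_hyperplane:
  fixes X :: "'i \<Rightarrow> 'a::{field,finite} ^ 6" and c :: "'i \<Rightarrow> real"
  assumes X: "\<And>i. i \<in> I \<Longrightarrow> X i \<noteq> 0" "\<And>i. i \<in> I \<Longrightarrow> klein_form (X i) = 0"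
    and F: "\<And>a. a \<noteq> 0 \<Longrightarrow> of_bool (a \<in> F) = (\<Sum>i\<in>I. c i * of_bool (skew (X i) a = 0))"
    and "0 \<notin> F"
  shows "real (card F) = (real CARD('a) ^ 2 - 1) * sum c I"
    and "real (card {a\<in>F. dotp a b = 0}) = (real CARD('a) - 1) *
      (sum c I + real CARD('a) * (\<Sum>i\<in>I. c i * of_bool (skew (flip (X i)) b = 0)))"
proof -
  have gen: "real (card {a\<in>F. P a}) =
      (\<Sum>i\<in>I. c i * real (card {a. a \<noteq> 0 \<and> skew (X i) a = 0 \<and> P a}))" for P
  proof -
    let ?N = "{a. a \<noteq> 0 \<and> P a}"
    have "{a\<in>F. P a} = ?N \<inter> {a. a \<in> F}" using \<open>0 \<notin> F\<close> by auto
    hence "real (card {a\<in>F. P a}) = (\<Sum>a\<in>?N. of_bool (a \<in> F))" by simp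
    also have "\<dots> = (\<Sum>a\<in>?N. \<Sum>i\<in>I. c i * of_bool (skew (X i) a = 0))"
      by (intro sum.cong) (auto simp: F)
    also have "\<dots> = (\<Sum>i\<in>I. \<Sum>a\<in>?N. c i * of_bool (skew (X i) a = 0))" by (rule sum.swap)
    also have "\<dots> = (\<Sum>i\<in>I. c i * real (card {a. a \<noteq> 0 \<and> skew (X i) a = 0 \<and> P a}))"
      by (intro sum.cong refl) (simp add: Int_def conj_ac flip: sum_distrib_left)
    finally show ?thesis .
  qed
  show "real (card F) = (real CARD('a) ^ 2 - 1) * sum c I"
    using gen[of "\<lambda>_. True"] X by (simp add: card_ker_skew_nonzero(1) sum_distrib_left mult.commute flip: sum_distrib_right)
  show "real (card {a\<in>F. dotp a b = 0}) = (real CARD('a) - 1) *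
      (sum c I + real CARD('a) * (\<Sum>i\<in>I. c i * of_bool (skew (flip (X i)) b = 0)))"
    unfolding gen sum_distrib_left sum.distrib[symmetric]
    by (intro sum.cong refl) (simp add: card_ker_skew_nonzero(2) X algebra_simps)
qed

section \<open>Points and planes with two intersection numbers\<close>

text \<open>
  What is needed of the points \<open>F\<close> and the planes \<open>H\<close> of a Cameron-Liebler set of parameter \<open>x\<close>: the sets are
  given by their nonzero representing vectors, whence the factors \<open>q - 1\<close>.
\<close>

locale balanced_pair =
  fixes F H :: "('a::{field,finite} ^ 4) set" and x :: real
  assumes zero_F: "0 \<notin> F" and zero_H: "0 \<notin> H"
    and scale_F: "a \<in> F \<Longrightarrow> s \<noteq> 0 \<Longrightarrow> s *s a \<in> F"
    and scale_H: "b \<in> H \<Longrightarrow> s \<noteq> 0 \<Longrightarrow> s *s b \<in> H"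
    and card_F: "real (card F) = (real CARD('a) ^ 2 - 1) * x"
    and card_F_plane: "b \<noteq> 0 \<Longrightarrow> real (card {a\<in>F. dotp a b = 0}) =
      (real CARD('a) - 1) * (x + real CARD('a) * of_bool (b \<in> H))"
    and card_H_plane: "a \<noteq> 0 \<Longrightarrow> real (card {b\<in>H. dotp a b = 0}) =
      (real CARD('a) - 1) * (x + real CARD('a) * of_bool (a \<in> F))"
begin

text \<open>
  Count the incident pairs of a point of \<open>F\<close> and a plane through the line of \<open>X\<close>. Each of the \<open>q + 1\<close> planes
  contributes \<open>x\<close>, and \<open>q\<close> more if it is in \<open>H\<close>; each point contributes \<open>1\<close>, and \<open>q\<close> more if it is on the line.
  As \<open>F\<close> has \<open>(q + 1) x\<close> points, the two excesses agree.
\<close>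

lemma line_balance:
  assumes X: "X \<noteq> 0" "klein_form X = 0"
  shows "real (card {a\<in>F. skew X a = 0}) = real (card {b\<in>H. skew (flip X) b = 0})"
proof -
  define q where "q = real CARD('a)"
  have q: "q > 1" using CARD_field_ge_2[where 'a='a] by (simp add: q_def)
  define N where "N = {c. c \<noteq> 0 \<and> skew (flip X) c = 0}"
  have N: "real (card N) = q ^ 2 - 1"
    using card_ker_skew_nonzero(1)[of "flip X"] X by (simp add: N_def q_def)
  have "(\<Sum>c\<in>N. real (card {a\<in>F. dotp a c = 0})) = (\<Sum>c\<in>N. (q - 1) * (x + q * of_bool (c \<in> H)))"
    by (rule sum.cong) (auto simp: N_def card_F_plane q_def)
  also have "\<dots> = (q - 1) * ((\<Sum>c\<in>N. x) + q * (\<Sum>c\<in>N. of_bool (c \<in> H)))"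
    by (simp add: sum.distrib flip: sum_distrib_left)
  also have "(\<Sum>c\<in>N. of_bool (c \<in> H)) = real (card {b\<in>H. skew (flip X) b = 0})"
  proof -
    have "N \<inter> {c. c \<in> H} = {b\<in>H. skew (flip X) b = 0}" using zero_H by (auto simp: N_def)
    thus ?thesis by simp
  qed
  finally have 1: "(\<Sum>c\<in>N. real (card {a\<in>F. dotp a c = 0})) =
      (q - 1) * ((q ^ 2 - 1) * x + q * real (card {b\<in>H. skew (flip X) b = 0}))"
    by (simp add: N)
  have "(\<Sum>c\<in>N. real (card {a\<in>F. dotp a c = 0})) = (\<Sum>a\<in>F. real (card {c\<in>N. dotp a c = 0}))"
    by (rule sum_card_swap) auto
  also have "\<dots> = (\<Sum>a\<in>F. (q - 1) * (1 + q * of_bool (skew X a = 0)))"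
  proof (rule sum.cong[OF refl])
    fix a
    have "{c\<in>N. dotp a c = 0} = {c. c \<noteq> 0 \<and> skew (flip X) c = 0 \<and> dotp c a = 0}"
      by (auto simp: N_def dotp_commute)
    thus "real (card {c\<in>N. dotp a c = 0}) = (q - 1) * (1 + q * of_bool (skew X a = 0))"
      using card_ker_skew_nonzero(2)[of "flip X" a] X by (simp add: q_def)
  qed
  also have "\<dots> = (q - 1) * (real (card F) + q * (\<Sum>a\<in>F. of_bool (skew X a = 0)))"
    by (simp add: sum.distrib flip: sum_distrib_left)
  also have "(\<Sum>a\<in>F. of_bool (skew X a = 0)) = real (card {a\<in>F. skew X a = 0})"
    by (simp add: Int_def)
  finally have 2: "(\<Sum>c\<in>N. real (card {a\<in>F. dotp a c = 0})) =
      (q - 1) * ((q ^ 2 - 1) * x + q * real (card {a\<in>F. skew X a = 0}))"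
    by (simp add: card_F q_def)
  show ?thesis using 1 2 q by simp
qed

text \<open>
  Bruen's argument in a plane \<open>b\<close> of \<open>H\<close>. Let \<open>s\<close> be the number of points of \<open>F\<close> on a line of the plane. Then
  \<open>s \<ge> 1\<close>, since \<open>s\<close> is also the number of planes of \<open>H\<close> on the line and \<open>b\<close> is one of them. If the line is not
  contained in \<open>F\<close>, then \<open>s \<le> x\<close>, since a point of the line outside \<open>F\<close> is on just \<open>x\<close> planes of
  \<open>H\<close>. So \<open>(s - 1) (s - x) \<le> 0\<close> on each line if no line is contained in \<open>F\<close>, whereas the first two moments
  of \<open>s\<close> give the sum \<open>q (q - (x - 1)\<^sup>2) > 0\<close> over all lines of the plane.
\<close>

lemma contains_full_line:
  assumes "F \<noteq> {}" "x \<ge> 0" "(x - 1) ^ 2 < real CARD('a)"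
  shows "\<exists>X. X \<noteq> 0 \<and> klein_form X = 0 \<and> {a. a \<noteq> 0 \<and> skew X a = 0} \<subseteq> F \<and>
    {b. b \<noteq> 0 \<and> skew (flip X) b = 0} \<subseteq> H"
proof (rule ccontr)
  assume none: "\<not> ?thesis"
  define q where "q = real CARD('a)"
  have q: "q > 1" using CARD_field_ge_2[where 'a='a] by (simp add: q_def)
  obtain b where b: "b \<in> H"
  proof -
    obtain a where a: "a \<in> F" using assms(1) by blast
    hence "a \<noteq> 0" using zero_F by auto
    hence "real (card {b\<in>H. dotp a b = 0}) > 0"
      using card_H_plane[of a] a q assms(2) by (simp add: q_def)
    hence "{b\<in>H. dotp a b = 0} \<noteq> {}" by force
    thus thesis using that by blast
  qed
  have b0: "b \<noteq> 0" using b zero_H by auto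
  \<comment> \<open>A line of the plane \<open>b\<close> is cut out by a second plane \<open>c\<close> in \<open>B\<close>; each line arises from \<open>q\<^sup>2 - q\<close> vectors
    \<open>c\<close>. The number of vectors of \<open>F\<close> on it is \<open>S c\<close>, which is \<open>q - 1\<close> times the number \<open>s\<close> of points.\<close>
  define T where "T = {a\<in>F. dotp a b = 0}"
  define B where "B = - range (\<lambda>s. s *s b)"
  define S where "S = (\<lambda>c. real (card {a\<in>T. dotp a c = 0}))"
  have T: "real (card T) = (q - 1) * (x + q)"
    using card_F_plane[OF b0] b by (simp add: T_def q_def)

  have bounds: "q - 1 \<le> S c" "S c \<le> (q - 1) * x" if c: "c \<in> B" for c
  proof -
    let ?X = "join b c"
    have X: "?X \<noteq> 0" "klein_form ?X = 0"
      using join_eq_0_imp_parallel[of b c] b0 c klein_form_join[of b c] by (auto simp: B_def)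
    have "{a\<in>F. skew ?X a = 0} = {a\<in>T. dotp a c = 0}"
      by (auto simp: T_def skew_join_eq_0_iff[OF X(1)] dotp_commute)
    hence S: "S c = real (card {d\<in>H. skew (flip ?X) d = 0})"
      using line_balance[OF X] by (simp add: S_def)
    \<comment> \<open>The plane \<open>b\<close> itself, with its \<open>q - 1\<close> representatives, gives the lower bound.\<close>
    have "(\<lambda>s. s *s b) ` (- {0}) \<subseteq> {d\<in>H. skew (flip ?X) d = 0}"
      using b scale_H by (auto simp: skew_flip_join)
    hence "card ((\<lambda>s. s *s b) ` (- {0})) \<le> card {d\<in>H. skew (flip ?X) d = 0}"
      by (intro card_mono) auto
    thus "q - 1 \<le> S c" unfolding card_line(2)[OF b0] S q_def by linarith
    have "\<not> {a. a \<noteq> 0 \<and> skew ?X a = 0} \<subseteq> F"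
    proof
      assume sub: "{a. a \<noteq> 0 \<and> skew ?X a = 0} \<subseteq> F"
      have "{a\<in>F. skew ?X a = 0} = {a. a \<noteq> 0 \<and> skew ?X a = 0}"
        using sub zero_F by auto
      hence "real (card {d\<in>H. skew (flip ?X) d = 0}) =
          real (card {d. d \<noteq> 0 \<and> skew (flip ?X) d = 0})"
        using line_balance[OF X] card_ker_skew_nonzero(1)[OF X]
          card_ker_skew_nonzero(1)[of "flip ?X"] X by simp
      moreover have "{d\<in>H. skew (flip ?X) d = 0} \<subseteq> {d. d \<noteq> 0 \<and> skew (flip ?X) d = 0}"
        using zero_H by auto
      ultimately have "{d\<in>H. skew (flip ?X) d = 0} = {d. d \<noteq> 0 \<and> skew (flip ?X) d = 0}"
        by (intro card_subset_eq) simp_all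
      thus False using none X sub by blast
    qed
    then obtain p where p: "p \<noteq> 0" "skew ?X p = 0" "p \<notin> F" by blast
    have "{d\<in>H. skew (flip ?X) d = 0} \<subseteq> {d\<in>H. dotp p d = 0}"
      using ker_skew_orthogonal[OF X p(2)] by blast
    hence "card {d\<in>H. skew (flip ?X) d = 0} \<le> card {d\<in>H. dotp p d = 0}"
      by (intro card_mono) auto
    thus "S c \<le> (q - 1) * x"
      using card_H_plane[OF p(1)] p(3) unfolding S q_def by simp
  qed

  have lineb: "real (card (range (\<lambda>s. s *s b))) = q" using card_line(1)[OF b0] by (simp add: q_def)
  have remove: "real (card {c\<in>B. P c}) = real (card {c. P c}) - q"
    if "\<And>s. P (s *s b)" for P
  proof -
    have "{c\<in>B. P c} = {c. P c} - range (\<lambda>s. s *s b)" by (auto simp: B_def)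
    moreover have "range (\<lambda>s. s *s b) \<subseteq> {c. P c}" using that by auto
    ultimately show ?thesis
      using lineb by (simp add: card_Diff_subset of_nat_diff card_mono)
  qed
  have cardB: "real (card B) = q ^ 4 - q"
    using remove[of "\<lambda>_. True"] by (simp add: q_def)
  have one: "real (card {c\<in>B. dotp a c = 0}) = q ^ 3 - q" if "a \<in> T" for a
    using remove[of "\<lambda>c. dotp a c = 0"] card_hyperplane[of a] that zero_F
    by (auto simp: T_def q_def dotp_commute)
  have two: "real (card {c\<in>B. dotp a c = 0 \<and> dotp a' c = 0}) =
      (q ^ 2 - q) + (q ^ 3 - q ^ 2) * of_bool (a' \<in> range (\<lambda>s. s *s a))"
    if a: "a \<in> T" "a' \<in> T" for a a'
  proof (cases "a' \<in> range (\<lambda>s. s *s a)")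
    case True
    then obtain s where "a' = s *s a" by blast
    hence "{c\<in>B. dotp a c = 0 \<and> dotp a' c = 0} = {c\<in>B. dotp a c = 0}" by auto
    thus ?thesis using one[OF a(1)] True by simp
  next
    case False
    have J: "join a a' \<noteq> 0"
      using join_eq_0_imp_parallel[of a a'] False a zero_F by (auto simp: T_def)
    have "card {c. dotp a c = 0 \<and> dotp a' c = 0} = CARD('a) ^ 2"
      using card_ker_skew[OF J klein_form_join] by (simp add: skew_join_eq_0_iff[OF J])
    thus ?thesis
      using remove[of "\<lambda>c. dotp a c = 0 \<and> dotp a' c = 0"] a False by (auto simp: T_def q_def)
  qed

  have sum1: "(\<Sum>c\<in>B. S c) = real (card T) * (q ^ 3 - q)"
  proof -
    have "(\<Sum>c\<in>B. S c) = (\<Sum>a\<in>T. real (card {c\<in>B. dotp a c = 0}))"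
      unfolding S_def by (rule sum_card_swap[of B T "\<lambda>c a. dotp a c = 0"]) auto
    thus ?thesis by (simp add: one)
  qed
  have sum2: "(\<Sum>c\<in>B. S c ^ 2) =
      real (card T) * (real (card T) * (q ^ 2 - q) + (q - 1) * (q ^ 3 - q ^ 2))"
  proof -
    have sq: "S c ^ 2 = real (card {z\<in>T \<times> T. dotp (fst z) c = 0 \<and> dotp (snd z) c = 0})" for c
    proof -
      have "{z\<in>T \<times> T. dotp (fst z) c = 0 \<and> dotp (snd z) c = 0} =
          {a\<in>T. dotp a c = 0} \<times> {a\<in>T. dotp a c = 0}" by auto
      thus ?thesis by (simp add: S_def card_cartesian_product power2_eq_square)
    qed
    have par: "(\<Sum>a'\<in>T. of_bool (a' \<in> range (\<lambda>s. s *s a))) = q - 1" if a: "a \<in> T" for a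
    proof -
      have "T \<inter> {a'. a' \<in> range (\<lambda>s. s *s a)} = (\<lambda>s. s *s a) ` (- {0})"
        using a zero_F scale_F by (auto simp: T_def)
      moreover have "a \<noteq> 0" using a zero_F by (auto simp: T_def)
      ultimately show ?thesis
        using card_line(2)[of a] q by (simp add: q_def of_nat_diff)
    qed
    have "(\<Sum>c\<in>B. S c ^ 2) =
        (\<Sum>z\<in>T \<times> T. real (card {c\<in>B. dotp (fst z) c = 0 \<and> dotp (snd z) c = 0}))"
      unfolding sq
      by (rule sum_card_swap[of B "T \<times> T" "\<lambda>c z. dotp (fst z) c = 0 \<and> dotp (snd z) c = 0"]) auto
    also have "\<dots> = (\<Sum>a\<in>T. \<Sum>a'\<in>T. real (card {c\<in>B. dotp a c = 0 \<and> dotp a' c = 0}))"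
      by (simp add: sum.cartesian_product case_prod_beta)
    also have "\<dots> = (\<Sum>a\<in>T. real (card T) * (q ^ 2 - q) + (q ^ 3 - q ^ 2) * (q - 1))"
    proof (rule sum.cong[OF refl])
      fix a assume a: "a \<in> T"
      have "(\<Sum>a'\<in>T. real (card {c\<in>B. dotp a c = 0 \<and> dotp a' c = 0})) =
        (\<Sum>a'\<in>T. (q ^ 2 - q) + (q ^ 3 - q ^ 2) * of_bool (a' \<in> range (\<lambda>s. s *s a)))"
        by (rule sum.cong[OF refl], rule two[OF a])
      also have "\<dots> = real (card T) * (q ^ 2 - q) + (q ^ 3 - q ^ 2) * (q - 1)"
        unfolding sum.distrib sum_distrib_left[symmetric] par[OF a] by simp
      finally show "(\<Sum>a'\<in>T. real (card {c\<in>B. dotp a c = 0 \<and> dotp a' c = 0})) =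
        real (card T) * (q ^ 2 - q) + (q ^ 3 - q ^ 2) * (q - 1)" .
    qed
    finally show ?thesis by (simp add: mult.commute)
  qed

  have "(\<Sum>c\<in>B. (S c - (q - 1)) * (S c - (q - 1) * x)) \<le> 0"
    using bounds by (intro sum_nonpos mult_nonneg_nonpos) auto
  moreover have "(\<Sum>c\<in>B. (S c - (q - 1)) * (S c - (q - 1) * x)) =
      (\<Sum>c\<in>B. S c ^ 2) - (q - 1) * (1 + x) * (\<Sum>c\<in>B. S c) + real (card B) * ((q - 1) ^ 2 * x)"
  proof -
    have "(S c - (q - 1)) * (S c - (q - 1) * x) =
        S c ^ 2 - (q - 1) * (1 + x) * S c + (q - 1) ^ 2 * x" for c
      by (simp add: power2_eq_square algebra_simps)
    thus ?thesis by (simp add: sum.distrib sum_subtractf sum_distrib_left)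
  qed
  \<comment> \<open>This is \<open>q (q - (x - 1)\<^sup>2)\<close> times \<open>(q - 1)\<^sup>2 (q\<^sup>2 - q)\<close>, the factor by which the sum over \<open>B\<close> exceeds the
    sum over the lines.\<close>
  moreover have "(\<Sum>c\<in>B. S c ^ 2) - (q - 1) * (1 + x) * (\<Sum>c\<in>B. S c)
      + real (card B) * ((q - 1) ^ 2 * x) = (q - 1) ^ 3 * q ^ 2 * (q - (x - 1) ^ 2)"
    unfolding sum1 sum2 T cardB by algebra
  moreover have "(q - 1) ^ 3 * q ^ 2 * (q - (x - 1) ^ 2) > 0"
    using q assms(3) by (simp add: q_def)
  ultimately show False by linarith
qed

end

section \<open>Cameron-Liebler sets of small parameter\<close>

text \<open>
  This identifies the parameter with the total weight, as every point-pencil has \<open>2 (q + 1)\<close> elements.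
\<close>

lemma card_eq_sum_weights:
  fixes L :: "('a::{field,finite} ^ 6) set set"
  assumes "L \<subseteq> generators"
    and "\<And>G. G \<in> generators \<Longrightarrow> of_bool (G \<in> L) = (\<Sum>P\<in>quadric_points. incidence_matrix P G * c P)"
  shows "real (card L) = 2 * (real CARD('a) + 1) * sum c quadric_points"
proof -
  have "real (card L) = (\<Sum>G\<in>generators. of_bool (G \<in> L))"
    using assms(1) by (simp add: Int_absorb1)
  also have "\<dots> = (\<Sum>G\<in>generators. \<Sum>P\<in>quadric_points. incidence_matrix P G * c P)"
    by (rule sum.cong) (simp_all add: assms(2))
  also have "\<dots> = (\<Sum>P\<in>quadric_points. \<Sum>G\<in>generators. incidence_matrix P G * c P)"
    by (rule sum.swap)
  also have "\<dots> = (\<Sum>P\<in>quadric_points. 2 * (real CARD('a) + 1) * c P)"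
  proof (rule sum.cong[OF refl])
    fix P :: "('a ^ 6) set" assume P: "P \<in> quadric_points"
    have "(\<Sum>G\<in>generators. incidence_matrix P G) = real (card (point_pencil P))"
      by (simp add: incidence_matrix_def point_pencil_def sum.If_cases Int_def)
    thus "(\<Sum>G\<in>generators. incidence_matrix P G * c P) = 2 * (real CARD('a) + 1) * c P"
      using card_point_pencil[OF P] by (simp flip: sum_distrib_right)
  qed
  finally show ?thesis by (simp add: sum_distrib_left)
qed

lemma contains_point_pencil:
  fixes L :: "('a::{field,finite} ^ 6) set set"
  assumes "L \<subseteq> generators" "L \<noteq> {}"
    and weights: "\<And>G. G \<in> generators \<Longrightarrow>
      of_bool (G \<in> L) = (\<Sum>P\<in>quadric_points. incidence_matrix P G * c P)"
    and small: "sum c quadric_points < sqrt (real CARD('a)) + 1"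
  obtains P where "P \<in> quadric_points" "point_pencil P \<subseteq> L"
proof -
  define q where "q = real CARD('a)"
  have q: "q > 1" using CARD_field_ge_2[where 'a='a] by (simp add: q_def)
  define x where "x = sum c quadric_points"
  have "real (card L) > 0" using assms(2) by (simp add: card_gt_0_iff)
  hence "0 < 2 * (q + 1) * x"
    using card_eq_sum_weights[OF assms(1) weights] by (simp add: x_def q_def)
  hence x: "x > 0" using q by (simp add: zero_less_mult_iff)
  have x2: "(x - 1) ^ 2 < q"
  proof (cases "x \<ge> 1")
    case True
    have "x - 1 < sqrt q" using small by (simp add: x_def q_def)
    hence "(x - 1) ^ 2 < sqrt q ^ 2" using True by (intro power_strict_mono) auto
    thus ?thesis using q by simp
  next
    case False
    hence "\<bar>x - 1\<bar> \<le> 1" using x by simp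
    hence "(x - 1) ^ 2 \<le> 1" using abs_square_le_1 by blast
    thus ?thesis using q by simp
  qed
  have "\<forall>P\<in>quadric_points. \<exists>X :: 'a ^ 6. X \<noteq> 0 \<and> klein_form X = 0 \<and> P = vec.span {X}"
    by (metis quadric_points_cases)
  then obtain X :: "('a ^ 6) set \<Rightarrow> 'a ^ 6" where X:
    "\<And>P. P \<in> quadric_points \<Longrightarrow> X P \<noteq> 0"
    "\<And>P. P \<in> quadric_points \<Longrightarrow> klein_form (X P) = 0"
    "\<And>P. P \<in> quadric_points \<Longrightarrow> P = vec.span {X P}"
    by metis
  define F where "F = {a. a \<noteq> 0 \<and> latin a \<in> L}"
  define H where "H = {b. b \<noteq> 0 \<and> greek b \<in> L}"
  have sub: "P \<subseteq> G \<longleftrightarrow> X P \<in> G" if "P \<in> quadric_points" "vec.subspace G" for P G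
    using span_subset_iff[OF that(2), of "X P"] X(3)[OF that(1)] by simp
  have F: "of_bool (a \<in> F) = (\<Sum>P\<in>quadric_points. c P * of_bool (skew (X P) a = 0))"
    if "a \<noteq> 0" for a
  proof -
    have "of_bool (a \<in> F) = (\<Sum>P\<in>quadric_points. incidence_matrix P (latin a) * c P)"
      using weights[OF latin_generator[OF that]] that by (simp add: F_def)
    also have "\<dots> = (\<Sum>P\<in>quadric_points. c P * of_bool (skew (X P) a = 0))"
    proof (rule sum.cong[OF refl])
      fix P :: "('a ^ 6) set" assume "P \<in> quadric_points"
      hence "P \<subseteq> latin a \<longleftrightarrow> skew (X P) a = 0"
        using sub[OF _ subspace_latin] by (simp add: latin_def)
      thus "incidence_matrix P (latin a) * c P = c P * of_bool (skew (X P) a = 0)"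
        by (simp add: incidence_matrix_def)
    qed
    finally show ?thesis .
  qed
  have H: "of_bool (b \<in> H) = (\<Sum>P\<in>quadric_points. c P * of_bool (skew (flip (X P)) b = 0))"
    if "b \<noteq> 0" for b
  proof -
    have "of_bool (b \<in> H) = (\<Sum>P\<in>quadric_points. incidence_matrix P (greek b) * c P)"
      using weights[OF greek_generator[OF that]] that by (simp add: H_def)
    also have "\<dots> = (\<Sum>P\<in>quadric_points. c P * of_bool (skew (flip (X P)) b = 0))"
    proof (rule sum.cong[OF refl])
      fix P :: "('a ^ 6) set" assume "P \<in> quadric_points"
      hence "P \<subseteq> greek b \<longleftrightarrow> skew (flip (X P)) b = 0"
        using sub[OF _ subspace_greek] by (simp add: greek_def)
      thus "incidence_matrix P (greek b) * c P = c P * of_bool (skew (flip (X P)) b = 0)"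
        by (simp add: incidence_matrix_def)
    qed
    finally show ?thesis .
  qed
  have zero: "0 \<notin> F" "0 \<notin> H" by (simp_all add: F_def H_def)
  note cF = weighted_lines_hyperplane[of quadric_points X F c, OF X(1,2) F zero(1)]
  note cH = weighted_lines_hyperplane[of quadric_points "\<lambda>P. flip (X P)" H c, OF _ _ H zero(2)]
  interpret balanced_pair F H x
  proof
    show "real (card F) = (real CARD('a) ^ 2 - 1) * x"
      using cF(1) by (simp add: x_def)
    show "real (card {a\<in>F. dotp a b = 0}) = (real CARD('a) - 1) * (x + real CARD('a) * of_bool (b \<in> H))"
      if "b \<noteq> 0" for b
      using cF(2)[of b] by (simp add: x_def H[OF that])
    show "real (card {b\<in>H. dotp a b = 0}) = (real CARD('a) - 1) * (x + real CARD('a) * of_bool (a \<in> F))"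
      if "a \<noteq> 0" for a
      using cH(2)[of a] X(1,2) by (simp add: x_def F[OF that] dotp_commute)
  qed (auto simp: F_def H_def latin_scale greek_scale)
  have "real (card F) > 0"
    unfolding card_F using x q by (simp add: q_def one_less_power)
  hence "F \<noteq> {}" by auto
  then obtain Y where Y: "Y \<noteq> 0" "klein_form Y = 0"
    "{a. a \<noteq> 0 \<and> skew Y a = 0} \<subseteq> F" "{b. b \<noteq> 0 \<and> skew (flip Y) b = 0} \<subseteq> H"
    using contains_full_line x x2 by (auto simp: q_def)
  have "point_pencil (vec.span {Y}) \<subseteq> L"
    using Y(3,4) unfolding point_pencil_span by (auto simp: F_def H_def)
  thus thesis using that span_quadric_point[OF Y(1,2)] by blast
qed

lemma disjoint_union_of_pencils:
  fixes L :: "('a::{field,finite} ^ 6) set set"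
  assumes "L \<subseteq> generators"
    and "\<And>G. G \<in> generators \<Longrightarrow>
      of_bool (G \<in> L) = (\<Sum>P\<in>quadric_points. incidence_matrix P G * c P)"
    and "sum c quadric_points < sqrt (real CARD('a)) + 1"
  shows "\<exists>S\<subseteq>quadric_points. disjoint_family_on point_pencil S \<and> L = (\<Union>P\<in>S. point_pencil P)"
  using assms
proof (induction "card L" arbitrary: L c rule: less_induct)
  case less
  show ?case
  proof (cases "L = {}")
    case True
    thus ?thesis by (intro exI[of _ "{}"]) (simp add: disjoint_family_on_def)
  next
    case False
    obtain P where P: "P \<in> quadric_points" "point_pencil P \<subseteq> L"
      using contains_point_pencil[OF less.prems(1) False less.prems(2,3)] by blast
    define c' where "c' = (\<lambda>R. c R - of_bool (R = P))"
    have ne: "point_pencil P \<noteq> {}"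
      using card_point_pencil[OF P(1)] by auto
    have smaller: "card (L - point_pencil P) < card L"
      using P(2) ne by (intro psubset_card_mono) auto
    have weights: "of_bool (G \<in> L - point_pencil P) =
        (\<Sum>R\<in>quadric_points. incidence_matrix R G * c' R)" if "G \<in> generators" for G
    proof -
      have "(\<Sum>R\<in>quadric_points. incidence_matrix R G * c' R) =
          (\<Sum>R\<in>quadric_points. incidence_matrix R G * c R)
            - (\<Sum>R\<in>quadric_points. incidence_matrix R G * of_bool (R = P))"
        by (simp add: c'_def algebra_simps sum_subtractf)
      also have "(\<Sum>R\<in>quadric_points. incidence_matrix R G * of_bool (R = P)) = incidence_matrix P G"
        using P(1) by (simp add: of_bool_def if_distrib[of "(*) _"] sum.delta cong: if_cong)
      also have "\<dots> = of_bool (G \<in> point_pencil P)"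
        using that by (simp add: incidence_matrix_def point_pencil_def)
      finally show ?thesis using less.prems(2)[OF that] P(2) by (auto split: if_splits)
    qed
    have "sum c' quadric_points = sum c quadric_points - 1"
      using P(1) by (simp add: c'_def sum_subtractf of_bool_def)
    hence small: "sum c' quadric_points < sqrt (real CARD('a)) + 1"
      using less.prems(3) by simp
    have "L - point_pencil P \<subseteq> generators" using less.prems(1) by auto
    from less.hyps[OF smaller this weights small] obtain S where
      S: "S \<subseteq> quadric_points" "disjoint_family_on point_pencil S"
        "L - point_pencil P = (\<Union>R\<in>S. point_pencil R)"
      by blast
    have disj: "point_pencil P \<inter> point_pencil R = {}" if "R \<in> S" for R
      using S(3) that by blast
    show ?thesis
    proof (intro exI[of _ "insert P S"] conjI)
      show "insert P S \<subseteq> quadric_points" using S(1) P(1) by simp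
      show "disjoint_family_on point_pencil (insert P S)"
        using S(2) disj by (auto simp: disjoint_family_on_def)
      show "L = (\<Union>R\<in>insert P S. point_pencil R)" using S(3) P(2) by auto
    qed
  qed
qed

text \<open>
  The line that joins collinear points is totally singular, hence contained in a generator, which lies in both pencils.
\<close>

lemma non_collinear_if_disjoint_pencils:
  assumes "P \<noteq> R" "point_pencil P \<inter> point_pencil R = {}"
  shows "non_collinear P R"
  unfolding non_collinear_def
proof (rule conjI[OF assms(1)], rule notI)
  assume "vec.span (P \<union> R) \<subseteq> klein_quadric"
  then obtain a where a: "a \<noteq> 0" "vec.span (P \<union> R) \<subseteq> latin a \<or> vec.span (P \<union> R) \<subseteq> greek a"
    using subspace_in_latin_or_greek[OF vec.subspace_span] by metis
  then obtain G where "G \<in> generators" "vec.span (P \<union> R) \<subseteq> G"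
    using latin_generator[OF a(1)] greek_generator[OF a(1)] by blast
  hence "G \<in> point_pencil P \<inter> point_pencil R"
    using vec.span_superset[of "P \<union> R"] by (auto simp: point_pencil_def)
  thus False using assms(2) by simp
qed

theorem theorem3p10:
  fixes L :: "('a::{field,finite} ^ 6) set set" and x :: real
  assumes "cameron_liebler_set L"
    and "has_parameter L x"
    and "1 \<le> x" and "x < sqrt (real CARD('a)) + 1"
  shows "\<exists>S \<subseteq> quadric_points. real (card S) = x \<and> pairwise non_collinear S \<and>
           L = (\<Union>P\<in>S. point_pencil P)"
proof -
  define q where "q = real CARD('a)"
  have q: "q > 0" by (simp add: q_def)
  have L: "L \<subseteq> generators" using assms(1) by (simp add: cameron_liebler_set_def)
  obtain c where c: "characteristic_vector L =
      (\<lambda>G\<in>generators. \<Sum>P\<in>quadric_points. incidence_matrix P G * c P)"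
    using assms(1) by (auto simp: cameron_liebler_set_def image_incidence_transpose_def)
  have weights: "of_bool (G \<in> L) = (\<Sum>P\<in>quadric_points. incidence_matrix P G * c P)"
    if "G \<in> generators" for G
    using fun_cong[OF c, of G] that by (simp add: characteristic_vector_def of_bool_def)
  have cardL: "real (card L) = 2 * x * (q + 1)"
    using assms(2) by (simp add: has_parameter_def q_def)
  hence "2 * (q + 1) * sum c quadric_points = 2 * (q + 1) * x"
    using card_eq_sum_weights[OF L weights] by (simp add: q_def algebra_simps)
  hence "sum c quadric_points = x" using q by simp
  hence "sum c quadric_points < sqrt (real CARD('a)) + 1" using assms(4) by simp
  from disjoint_union_of_pencils[OF L weights this] obtain S where
    S: "S \<subseteq> quadric_points" "disjoint_family_on point_pencil S" "L = (\<Union>P\<in>S. point_pencil P)"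
    by blast
  have "card L = (\<Sum>P\<in>S. card (point_pencil P))"
    using S(2) unfolding S(3) disjoint_family_on_def by (intro card_UN_disjoint) auto
  also have "\<dots> = card S * (2 * (CARD('a) + 1))"
  proof -
    have "(\<Sum>P\<in>S. card (point_pencil P)) = (\<Sum>P\<in>S. 2 * (CARD('a) + 1))"
      using S(1) card_point_pencil by (intro sum.cong) auto
    thus ?thesis by simp
  qed
  finally have "2 * (q + 1) * real (card S) = 2 * (q + 1) * x"
    using cardL by (simp add: q_def algebra_simps)
  hence "real (card S) = x" using q by simp
  moreover have "pairwise non_collinear S"
    using S(2) by (intro pairwiseI non_collinear_if_disjoint_pencils)
      (simp_all add: disjoint_family_on_def)
  ultimately show ?thesis using S(1,3) by blast
qed

end
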